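(* For $z\in\mathbb{C}$ and $t\in\mathbb{R}$ let $$f(z,t)=(z^2+2it)-z,\qquad g(z,t)=(z^3-6itz)-z,$$ $$h(z,t)=\tfrac32 z^4-z^3-(1+6it)z^2+(1+6it)z-i(t^2+4it^3)-\tfrac12 .$$ Then, with $'$ denoting $\partial/\partial z$: (1) $f$ and $g$ satisfy the linear equations $f_t=i f''$ and $g_t=-i g''$. Moreover $f'=2z-1$, $g'=3z^2-(1+6it)$, and $$h'=f'g'=6z^3-3z^2-2(1+6it)z+(1+6it).$$ With the temporal term $-i(t^2+4it^3)$ in $h$, the constraint $i h_t=g''f'-g'f''$ is met, and with the constant $-\frac12$ in $h$, $h|_{t=0}$ vanishes at $z=\pm1$. (2) The data triple $(f,g,h)$ yields the following solution of the Davey--Stewartson II equation (at points where the denominator does not vanish): $$U=i\,\overline{g'}\,\frac{f'g-h}{|g|^2+|h|^2} =\frac{i\left(3\overline z^2-(1-6it)\right)\left(\frac12 z^4-(1+6it)z^2+i(t^2+4it^3)+\frac12\right)}{\left|(z^3-6itz)-z\right|^2+\left|\frac32 z^4-z^3-(1+6it)z^2+(1+6it)z-i(t^2+4it^3)-\frac12\right|^2}.$$ (3) One has $$h|_{t=0}=\tfrac32 z^4-z^3-z^2+z-\tfrac12=(z^2-1)\left(\tfrac32 z^2-z+\tfrac12\right),\qquad g|_{t=0}=z(z^2-1),$$ $$g'|_{t=0}\neq0 \text{ at } z=\pm1,\qquad (f'g-h)|_{t=0}=\frac{(z^2-1)^2}{2}.$$ Thus at $t=0$ the solution $U$ has a two-point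 indeterminacy type singularity, at $z=1$ and $z=-1$: there are constants $C_{1},C_{-1}$ (which can be computed directly) such that $$U|_{t=0}\sim C_{\pm1}\,\frac{(z^2-1)^2}{|z^2-1|^2}\qquad\text{as } z\to\pm1 .$$
   Context: Write $z=x+iy$, $\partial_z=\frac12(\partial_x-i\partial_y)$, $\partial_{\bar z}=\frac12(\partial_x+i\partial_y)$; subscripts $z,\bar z,t$ denote the corresponding derivatives. A complex-valued function $U(z,t)$ satisfies the Davey--Stewartson II equation if there is a function $V$ such that $$U_t=i\left(U_{zz}+U_{\bar z\bar z}+2(V+\overline V)U\right),\qquad V_{\bar z}=(|U|^2)_z .$$ The notation $A(z)\sim B(z)$ as $z\to z_0$ means $A(z)/B(z)\to 1$ as $z\to z_0$, $z\ne z_0$.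
   Formalization: The temporal term −i(t²+4it³) in h (and in the formula for U) is replaced by −i(2t+6it²): with the printed term, i h_t = g''f'−g'f'' fails at z=0, t=0 (0 against 2) and U does not solve the equation at z=i, t=0. *)

theory Defs
  imports "HOL-Analysis.Analysis"
begin

text \<open>
  Wirtinger operators, written with the real Frechet derivative on the plane. They carry the
  mathematical meaning only for real-differentiable arguments, hence the explicit differentiability
  requirements in \<open>solves_DSII\<close>.
\<close>

definition wirt :: "(complex \<Rightarrow> complex) \<Rightarrow> complex \<Rightarrow> complex" where
  "wirt F z = (frechet_derivative F (at z) 1 - \<i> * frechet_derivative F (at z) \<i>) / 2"

definition wirt_bar :: "(complex \<Rightarrow> complex) \<Rightarrow> complex \<Rightarrow> complex" where
  "wirt_bar F z = (frechet_derivative F (at z) 1 + \<i> * frechet_derivative F (at z) \<i>) / 2"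

text \<open>Derivatives of functions of \<open>(z, t)\<close>: \<open>zder\<close> is the complex derivative in \<open>z\<close>.\<close>

definition zder :: "(complex \<Rightarrow> real \<Rightarrow> complex) \<Rightarrow> complex \<Rightarrow> real \<Rightarrow> complex" where
  "zder F z t = deriv (\<lambda>w. F w t) z"

definition tder :: "(complex \<Rightarrow> real \<Rightarrow> complex) \<Rightarrow> complex \<Rightarrow> real \<Rightarrow> complex" where
  "tder F z t = vector_derivative (F z) (at t)"

definition solves_DSII_with ::
  "(complex \<Rightarrow> real \<Rightarrow> complex) \<Rightarrow> (complex \<Rightarrow> real \<Rightarrow> complex) \<Rightarrow> (complex \<times> real) set \<Rightarrow> bool" where
  "solves_DSII_with U V \<Omega> \<longleftrightarrow>
    (\<forall>(z, t) \<in> \<Omega>.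
      U z differentiable (at t) \<and>
      (\<lambda>w. U w t) differentiable (at z) \<and>
      wirt (\<lambda>w. U w t) differentiable (at z) \<and>
      wirt_bar (\<lambda>w. U w t) differentiable (at z) \<and>
      (\<lambda>w. V w t) differentiable (at z) \<and>
      tder U z t =
        \<i> * (wirt (wirt (\<lambda>w. U w t)) z + wirt_bar (wirt_bar (\<lambda>w. U w t)) z
              + 2 * (V z t + cnj (V z t)) * U z t) \<and>
      wirt_bar (\<lambda>w. V w t) z = wirt (\<lambda>w. complex_of_real ((cmod (U w t))\<^sup>2)) z)"

definition solves_DSII :: "(complex \<Rightarrow> real \<Rightarrow> complex) \<Rightarrow> (complex \<times> real) set \<Rightarrow> bool" where
  "solves_DSII U \<Omega> \<longleftrightarrow> (\<exists>V. solves_DSII_with U V \<Omega>)"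

definition data_denom ::
  "(complex \<Rightarrow> real \<Rightarrow> complex) \<Rightarrow> (complex \<Rightarrow> real \<Rightarrow> complex) \<Rightarrow> complex \<Rightarrow> real \<Rightarrow> real" where
  "data_denom g h z t = (cmod (g z t))\<^sup>2 + (cmod (h z t))\<^sup>2"

definition data_U ::
  "(complex \<Rightarrow> real \<Rightarrow> complex) \<Rightarrow> (complex \<Rightarrow> real \<Rightarrow> complex) \<Rightarrow> (complex \<Rightarrow> real \<Rightarrow> complex)
    \<Rightarrow> complex \<Rightarrow> real \<Rightarrow> complex" where
  "data_U f g h z t =
    \<i> * cnj (zder g z t) * (zder f z t * g z t - h z t) / complex_of_real (data_denom g h z t)"

text \<open>Bounded near the point, but with no limit there (the limit depends on the direction).\<close>

definition indeterminacy_at :: "(complex \<Rightarrow> complex) \<Rightarrow> complex \<Rightarrow> bool" where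
  "indeterminacy_at F a \<longleftrightarrow> Bfun F (at a) \<and> (\<nexists>L. (F \<longlongrightarrow> L) (at a))"

definition f0 :: "complex \<Rightarrow> real \<Rightarrow> complex" where
  "f0 z t = (z^2 + 2 * \<i> * of_real t) - z"

definition g0 :: "complex \<Rightarrow> real \<Rightarrow> complex" where
  "g0 z t = (z^3 - 6 * \<i> * of_real t * z) - z"

text \<open>
  The temporal term of \<open>h0\<close> is forced, up to a constant, by \<open>\<i> h\<^sub>t = g'' f' - g' f''\<close>, that is, by
  \<open>\<i> h\<^sub>t = 6 z\<^sup>2 - 6 z + 2 + 12 \<i> t\<close>. It is \<open>- \<i> (2 t + 6 \<i> t\<^sup>2)\<close>; the term \<open>- \<i> (t\<^sup>2 + 4 \<i> t\<^sup>3)\<close>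
  printed in the source comes from integrating \<open>2 t + 12 \<i> t\<^sup>2\<close> instead of \<open>2 + 12 \<i> t\<close> and violates
  the constraint (see \<open>h0_printed_violates_constraint\<close>).
\<close>

definition h0 :: "complex \<Rightarrow> real \<Rightarrow> complex" where
  "h0 z t = 3/2 * z^4 - z^3 - (1 + 6 * \<i> * of_real t) * z^2 + (1 + 6 * \<i> * of_real t) * z
     - \<i> * (2 * of_real t + 6 * \<i> * (of_real t)^2) - 1/2"

definition h0_printed :: "complex \<Rightarrow> real \<Rightarrow> complex" where
  "h0_printed z t = 3/2 * z^4 - z^3 - (1 + 6 * \<i> * of_real t) * z^2 + (1 + 6 * \<i> * of_real t) * z
     - \<i> * ((of_real t)^2 + 4 * \<i> * (of_real t)^3) - 1/2"

lemma h0_printed_violates_constraint: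
  "\<i> * tder h0_printed 0 0 \<noteq> zder (zder g0) 0 0 * zder f0 0 0 - zder g0 0 0 * zder (zder f0) 0 0"
proof -
  have f1: "zder f0 = (\<lambda>z t. 2 * z - 1)"
    unfolding zder_def f0_def
    by (intro ext DERIV_imp_deriv) (auto intro!: derivative_eq_intros)
  have f2: "zder (zder f0) = (\<lambda>z t. 2)"
    unfolding f1 unfolding zder_def
    by (intro ext DERIV_imp_deriv) (auto intro!: derivative_eq_intros)
  have g1: "zder g0 = (\<lambda>z t. 3 * z^2 - 6 * \<i> * of_real t - 1)"
    unfolding zder_def g0_def
    by (intro ext DERIV_imp_deriv) (auto intro!: derivative_eq_intros)
  have g2: "zder (zder g0) = (\<lambda>z t. 6 * z)"
    unfolding g1 unfolding zder_def
    by (intro ext DERIV_imp_deriv) (auto intro!: derivative_eq_intros)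
  have "((\<lambda>s. - \<i> * (s^2 + 4 * \<i> * s^3) - 1/2) has_field_derivative 0) (at (of_real 0 :: complex))"
    by (auto intro!: derivative_eq_intros)
  then have "((\<lambda>s::real. - \<i> * (of_real s^2 + 4 * \<i> * of_real s^3) - 1/2)
      has_vector_derivative 0) (at 0)"
    by (rule has_vector_derivative_real_field)
  then have "tder h0_printed 0 0 = 0"
    unfolding tder_def h0_printed_def by (intro vector_derivative_at) simp
  then show ?thesis
    unfolding f2 g2 unfolding f1 g1 by simp
qed

definition U0 :: "complex \<Rightarrow> real \<Rightarrow> complex" where
  "U0 = data_U f0 g0 h0"

definition \<Omega>0 :: "(complex \<times> real) set" where
  "\<Omega>0 = {(z, t). data_denom g0 h0 z t \<noteq> 0}"

end

theory Submission
  imports Defs "HOL-Complex_Analysis.Cauchy_Integral_Formula"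
begin

text \<open>
Write \<open>D = |g|\<^sup>2 + |h|\<^sup>2\<close>. Two observations make \<open>U = \<i> cnj(g') (f' g - h) / D\<close> a solution.
Since \<open>h' = f' g'\<close>, the Wronskian is \<open>g h' - h g' = g' (f' g - h)\<close>, so that
\<open>|U|\<^sup>2 = |g h' - h g'|\<^sup>2 / D\<^sup>2 = \<partial>\<^sub>z \<partial>\<^sub>b log D\<close> (\<open>data_modulus_identity\<close>; the subscript \<open>b\<close> stands for
the derivative in the conjugate variable). Hence the potential may be taken
to be \<open>V = \<partial>\<^sub>z\<^sup>2 log D\<close>, and the equation for \<open>V\<close> is the symmetry of third derivatives of \<open>log D\<close>
(\<open>wirt_bar_log_zz_eq_wirt_log_zb\<close>).

With this \<open>V\<close>, and with \<open>p = g'\<close> and \<open>q = f' g - h\<close>, the cubic term \<open>2 (V + cnj V) U\<close> cancels all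
terms with \<open>1/D\<^sup>3\<close> in \<open>U\<^sub>z\<^sub>z\<close> and \<open>U\<^sub>b\<^sub>b\<close>. In what is left, the relations \<open>q' = f'' g\<close> and
\<open>D g' - g D\<^sub>z = - g' q cnj h\<close> reduce the evolution equation to
\<open>\<i> D\<^sub>t = (g'' f' - g' f'') cnj h - cnj (g'' f' - g' f'') h + g'' cnj g - g cnj g''\<close>, which is what
\<open>g\<^sub>t = - \<i> g''\<close> and \<open>\<i> h\<^sub>t = g'' f' - g' f''\<close> say (\<open>data_evolution_identity\<close>). The general result is
\<open>data_solves_DSII\<close>; the given polynomials satisfy its hypotheses.

At \<open>t = 0\<close> the polynomials \<open>g\<close> and \<open>h\<close> have the common factor \<open>P = z\<^sup>2 - 1\<close>, and \<open>f' g - h = P\<^sup>2 / 2\<close>.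
So \<open>U = K P\<^sup>2 / |P|\<^sup>2 = K (sgn P)\<^sup>2\<close> with an amplitude \<open>K\<close> continuous and nonzero at \<open>z = 1\<close> and
\<open>z = -1\<close>. The modulus of \<open>U\<close> has a limit there, but \<open>(sgn P)\<^sup>2\<close> turns twice around the circle while \<open>z\<close>
goes once around a simple zero of \<open>P\<close>: its limits along perpendicular rays are opposite
(\<open>indeterminacy_at_sgn_squared\<close>).
\<close>

section \<open>Calculus of Wirtinger derivatives\<close>

text \<open>
An \<open>\<real>\<close>-linear map of the plane is \<open>v \<mapsto> a v + b cnj v\<close> for unique \<open>a\<close> and \<open>b\<close>; for a derivative these
are the two Wirtinger derivatives. Keeping differentiability and both values in one relation lets
the product, quotient and conjugation rules compose, which \<open>wirt\<close> alone does not allow.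
\<close>

definition has_wirt :: "(complex \<Rightarrow> complex) \<Rightarrow> complex \<Rightarrow> complex \<Rightarrow> complex \<Rightarrow> bool" where
  "has_wirt F a b z \<longleftrightarrow> (F has_derivative (\<lambda>v. a * v + b * cnj v)) (at z)"

lemma has_wirt_imp_differentiable: "has_wirt F a b z \<Longrightarrow> F differentiable (at z)"
  unfolding has_wirt_def differentiable_def by blast

lemma has_wirt_imp_wirt:
  assumes "has_wirt F a b z"
  shows "wirt F z = a" "wirt_bar F z = b"
proof -
  have "frechet_derivative F (at z) = (\<lambda>v. a * v + b * cnj v)"
    using assms unfolding has_wirt_def by (rule frechet_derivative_at[symmetric])
  then show "wirt F z = a" "wirt_bar F z = b"
    unfolding wirt_def wirt_bar_def by (simp_all add: algebra_simps)
qed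

lemma has_wirt_cong_open:
  assumes "has_wirt F a b z" "open S" "z \<in> S" "\<And>w. w \<in> S \<Longrightarrow> G w = F w"
  shows "has_wirt G a b z"
  using has_derivative_transform_within_open[OF assms(1)[unfolded has_wirt_def] assms(2,3)] assms(4)
  unfolding has_wirt_def by simp

lemma has_wirt_holo: "(F has_field_derivative a) (at z) \<Longrightarrow> has_wirt F a 0 z"
  unfolding has_wirt_def has_field_derivative_def by simp

lemma has_wirt_const: "has_wirt (\<lambda>w. c) 0 0 z"
  unfolding has_wirt_def by simp

lemma has_wirt_cnj:
  assumes "has_wirt F a b z"
  shows "has_wirt (\<lambda>w. cnj (F w)) (cnj b) (cnj a) z"
proof -
  have "((\<lambda>w. cnj (F w)) has_derivative (\<lambda>v. cnj (a * v + b * cnj v))) (at z)"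
    using bounded_linear.has_derivative[OF bounded_linear_cnj assms[unfolded has_wirt_def]] .
  then show ?thesis unfolding has_wirt_def by (simp add: add.commute)
qed

lemma has_wirt_add:
  assumes "has_wirt F a b z" "has_wirt G c d z"
  shows "has_wirt (\<lambda>w. F w + G w) (a + c) (b + d) z"
  using has_derivative_add[OF assms[unfolded has_wirt_def]]
  unfolding has_wirt_def by (simp add: algebra_simps)

lemma has_wirt_diff:
  assumes "has_wirt F a b z" "has_wirt G c d z"
  shows "has_wirt (\<lambda>w. F w - G w) (a - c) (b - d) z"
  using has_derivative_diff[OF assms[unfolded has_wirt_def]]
  unfolding has_wirt_def by (simp add: algebra_simps)

lemma has_wirt_mult:
  assumes "has_wirt F a b z" "has_wirt G c d z"
  shows "has_wirt (\<lambda>w. F w * G w) (a * G z + F z * c) (b * G z + F z * d) z"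
  using has_derivative_mult[OF assms[unfolded has_wirt_def]]
  unfolding has_wirt_def by (simp add: algebra_simps)

lemma has_wirt_inverse:
  assumes "has_wirt F a b z" "F z \<noteq> 0"
  shows "has_wirt (\<lambda>w. inverse (F w)) (- a * (inverse (F z))^2) (- b * (inverse (F z))^2) z"
proof -
  have "((\<lambda>w. inverse (F w)) has_derivative
      (\<lambda>v. - (inverse (F z) * (a * v + b * cnj v) * inverse (F z)))) (at z)"
    using Deriv.has_derivative_inverse[OF assms(2) assms(1)[unfolded has_wirt_def]] .
  then show ?thesis
    unfolding has_wirt_def
    by (rule has_derivative_eq_rhs) (simp add: fun_eq_iff power2_eq_square ring_distribs mult_ac)
qed

lemma has_wirt_eq: "has_wirt F a b z \<Longrightarrow> a = a' \<Longrightarrow> b = b' \<Longrightarrow> has_wirt F a' b' z"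
  by simp

text \<open>
The operators \<open>wirt\<close> and \<open>wirt_bar\<close> are iterated, so the first derivatives must be known on a whole
neighbourhood \<open>S\<close> of \<open>z\<close>. As \<open>p\<close> and \<open>q\<close> are holomorphic, differentiation in \<open>z\<close> does not touch
\<open>cnj p\<close> and differentiation in the conjugate variable does not touch \<open>q\<close>. The results are written
as polynomials in \<open>E = 1/D\<close>, the form in which they cancel later.
\<close>

lemma second_wirt_quotient:
  assumes S: "open S" "z \<in> S"
    and p: "\<And>w. w \<in> S \<Longrightarrow> (p has_field_derivative p1 w) (at w)"
      "\<And>w. w \<in> S \<Longrightarrow> (p1 has_field_derivative p2 w) (at w)"
    and q: "\<And>w. w \<in> S \<Longrightarrow> (q has_field_derivative q1 w) (at w)"
      "\<And>w. w \<in> S \<Longrightarrow> (q1 has_field_derivative q2 w) (at w)"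
    and D: "\<And>w. w \<in> S \<Longrightarrow> has_wirt D (D\<^sub>z w) (D\<^sub>b w) w"
      "\<And>w. w \<in> S \<Longrightarrow> has_wirt D\<^sub>z (D\<^sub>z\<^sub>z w) (D\<^sub>z\<^sub>b w) w"
      "\<And>w. w \<in> S \<Longrightarrow> has_wirt D\<^sub>b (D\<^sub>z\<^sub>b w) (D\<^sub>b\<^sub>b w) w"
    and D0: "\<And>w. w \<in> S \<Longrightarrow> D w \<noteq> 0"
  defines "E \<equiv> \<lambda>w. inverse (D w)"
  assumes U: "\<And>w. w \<in> S \<Longrightarrow> U w = \<i> * cnj (p w) * q w * E w"
  shows "U differentiable (at z)"
    and "wirt U differentiable (at z)"
    and "wirt_bar U differentiable (at z)"
    and "wirt (wirt U) z = \<i> * cnj (p z) *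
      (q2 z * E z - 2 * q1 z * D\<^sub>z z * (E z)^2 - q z * D\<^sub>z\<^sub>z z * (E z)^2 + 2 * q z * (D\<^sub>z z)^2 * (E z)^3)"
    and "wirt_bar (wirt_bar U) z = \<i> * q z *
      (cnj (p2 z) * E z - 2 * cnj (p1 z) * D\<^sub>b z * (E z)^2 - cnj (p z) * D\<^sub>b\<^sub>b z * (E z)^2
        + 2 * cnj (p z) * (D\<^sub>b z)^2 * (E z)^3)"
proof -
  define E\<^sub>z where "E\<^sub>z w = - D\<^sub>z w * (E w * E w)" for w
  define E\<^sub>b where "E\<^sub>b w = - D\<^sub>b w * (E w * E w)" for w
  have wE: "has_wirt E (E\<^sub>z w) (E\<^sub>b w) w" if "w \<in> S" for w
    using has_wirt_inverse[OF D(1)[OF that] D0[OF that]]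
    unfolding E_def E\<^sub>z_def E\<^sub>b_def power2_eq_square by simp
  note wp = has_wirt_cnj[OF has_wirt_holo[OF p(1)]] has_wirt_cnj[OF has_wirt_holo[OF p(2)]]
    and wq = has_wirt_holo[OF q(1)] has_wirt_holo[OF q(2)]
  define U\<^sub>z where "U\<^sub>z w = \<i> * cnj (p w) * (q1 w * E w + q w * E\<^sub>z w)" for w
  define U\<^sub>b where "U\<^sub>b w = \<i> * q w * (cnj (p1 w) * E w + cnj (p w) * E\<^sub>b w)" for w
  have wU: "has_wirt U (U\<^sub>z w) (U\<^sub>b w) w" if "w \<in> S" for w
  proof -
    have "has_wirt (\<lambda>w. \<i> * cnj (p w) * q w * E w) (U\<^sub>z w) (U\<^sub>b w) w"
      by (rule has_wirt_eq[OF has_wirt_mult[OF has_wirt_mult[OF has_wirt_mult[OF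
            has_wirt_const wp(1)] wq(1)] wE]]) (simp_all add: that U\<^sub>z_def U\<^sub>b_def ring_distribs mult_ac)
    then show ?thesis using has_wirt_cong_open[OF _ S(1) that, of _ _ _ U] U by simp
  qed
  have wEz: "has_wirt E\<^sub>z (- D\<^sub>z\<^sub>z w * (E w * E w) - 2 * D\<^sub>z w * (E w * E\<^sub>z w))
      (- D\<^sub>z\<^sub>b w * (E w * E w) - 2 * D\<^sub>z w * (E w * E\<^sub>b w)) w" if "w \<in> S" for w
  proof -
    have *: "E\<^sub>z = (\<lambda>w. 0 - D\<^sub>z w * (E w * E w))" by (simp add: E\<^sub>z_def fun_eq_iff)
    show ?thesis unfolding *
      by (rule has_wirt_eq[OF has_wirt_diff[OF has_wirt_const has_wirt_mult[OF
            D(2)[OF that] has_wirt_mult[OF wE wE]]]]) (simp_all add: that * ring_distribs mult_ac)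
  qed
  have wEb: "has_wirt E\<^sub>b (- D\<^sub>z\<^sub>b w * (E w * E w) - 2 * D\<^sub>b w * (E w * E\<^sub>z w))
      (- D\<^sub>b\<^sub>b w * (E w * E w) - 2 * D\<^sub>b w * (E w * E\<^sub>b w)) w" if "w \<in> S" for w
  proof -
    have *: "E\<^sub>b = (\<lambda>w. 0 - D\<^sub>b w * (E w * E w))" by (simp add: E\<^sub>b_def fun_eq_iff)
    show ?thesis unfolding *
      by (rule has_wirt_eq[OF has_wirt_diff[OF has_wirt_const has_wirt_mult[OF
            D(3)[OF that] has_wirt_mult[OF wE wE]]]]) (simp_all add: that * ring_distribs mult_ac)
  qed
  have wUz: "has_wirt (wirt U) a b z" if "has_wirt U\<^sub>z a b z" for a b
    using has_wirt_cong_open[OF that S] has_wirt_imp_wirt(1)[OF wU] by simp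
  have wUb: "has_wirt (wirt_bar U) a b z" if "has_wirt U\<^sub>b a b z" for a b
    using has_wirt_cong_open[OF that S] has_wirt_imp_wirt(2)[OF wU] by simp
  show "U differentiable (at z)" by (rule has_wirt_imp_differentiable[OF wU[OF S(2)]])
  have Uz: "\<exists>b. has_wirt (wirt U) (\<i> * cnj (p z) * (q2 z * E z + 2 * q1 z * E\<^sub>z z
      + q z * (- D\<^sub>z\<^sub>z z * (E z * E z) - 2 * D\<^sub>z z * (E z * E\<^sub>z z)))) b z"
    by (rule exI, rule wUz[unfolded U\<^sub>z_def[abs_def]], rule has_wirt_eq[OF has_wirt_mult[OF
          has_wirt_mult[OF has_wirt_const wp(1)] has_wirt_add[OF has_wirt_mult[OF wq(2) wE]
          has_wirt_mult[OF wq(1) wEz]]] _ refl])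
      (simp_all add: S ring_distribs mult_ac)
  have Ub: "\<exists>a. has_wirt (wirt_bar U) a (\<i> * q z * (cnj (p2 z) * E z + 2 * cnj (p1 z) * E\<^sub>b z
      + cnj (p z) * (- D\<^sub>b\<^sub>b z * (E z * E z) - 2 * D\<^sub>b z * (E z * E\<^sub>b z)))) z"
    by (rule exI, rule wUb[unfolded U\<^sub>b_def[abs_def]], rule has_wirt_eq[OF has_wirt_mult[OF
          has_wirt_mult[OF has_wirt_const wq(1)] has_wirt_add[OF has_wirt_mult[OF wp(2) wE]
          has_wirt_mult[OF wp(1) wEb]]] refl])
      (simp_all add: S ring_distribs mult_ac)
  show "wirt U differentiable (at z)" "wirt_bar U differentiable (at z)"
    using Uz Ub has_wirt_imp_differentiable by blast+
  show "wirt (wirt U) z = \<i> * cnj (p z) *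
      (q2 z * E z - 2 * q1 z * D\<^sub>z z * (E z)^2 - q z * D\<^sub>z\<^sub>z z * (E z)^2 + 2 * q z * (D\<^sub>z z)^2 * (E z)^3)"
    using Uz has_wirt_imp_wirt(1) unfolding E\<^sub>z_def
    by (auto simp: algebra_simps power2_eq_square power3_eq_cube)
  show "wirt_bar (wirt_bar U) z = \<i> * q z *
      (cnj (p2 z) * E z - 2 * cnj (p1 z) * D\<^sub>b z * (E z)^2 - cnj (p z) * D\<^sub>b\<^sub>b z * (E z)^2
        + 2 * cnj (p z) * (D\<^sub>b z)^2 * (E z)^3)"
    using Ub has_wirt_imp_wirt(2) unfolding E\<^sub>b_def
    by (auto simp: algebra_simps power2_eq_square power3_eq_cube)
qed

section \<open>Solutions of the Davey--Stewartson equation from holomorphic data\<close>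

text \<open>
Here \<open>V = \<partial>\<^sub>z\<^sup>2 log D\<close> and \<open>R = \<partial>\<^sub>z \<partial>\<^sub>b log D\<close>, so the common value \<open>b\<close> is \<open>\<partial>\<^sub>z\<^sup>2 \<partial>\<^sub>b log D\<close>. The only
symmetries that enter are those of the second and third derivatives of \<open>D\<close> itself.
\<close>

lemma wirt_bar_log_zz_eq_wirt_log_zb:
  assumes D: "has_wirt D (D\<^sub>z z) (D\<^sub>b z) z" "D z \<noteq> 0"
    and D1: "has_wirt D\<^sub>z (D\<^sub>z\<^sub>z z) (D\<^sub>z\<^sub>b z) z" "has_wirt D\<^sub>b (D\<^sub>z\<^sub>b z) D\<^sub>b\<^sub>b z"
    and D2: "has_wirt D\<^sub>z\<^sub>z D\<^sub>z\<^sub>z\<^sub>z D\<^sub>z\<^sub>z\<^sub>b z" "has_wirt D\<^sub>z\<^sub>b D\<^sub>z\<^sub>z\<^sub>b D\<^sub>z\<^sub>b\<^sub>b z"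
  defines "E \<equiv> \<lambda>w. inverse (D w)"
  defines "V \<equiv> \<lambda>w. D\<^sub>z\<^sub>z w * E w - (D\<^sub>z w * E w) * (D\<^sub>z w * E w)"
    and "R \<equiv> \<lambda>w. D\<^sub>z\<^sub>b w * E w - (D\<^sub>z w * E w) * (D\<^sub>b w * E w)"
  obtains a b c where "has_wirt V a b z" "has_wirt R b c z"
proof -
  have E: "has_wirt E (- D\<^sub>z z * (E z)^2) (- D\<^sub>b z * (E z)^2) z"
    using has_wirt_inverse[OF D] by (simp add: E_def)
  note DE = has_wirt_mult[OF D1(1) E] has_wirt_mult[OF D1(2) E]
  show thesis
    by (rule that[OF has_wirt_diff[OF has_wirt_mult[OF D2(1) E] has_wirt_mult[OF DE(1) DE(1)],
              folded V_def]
          has_wirt_eq[OF has_wirt_diff[OF has_wirt_mult[OF D2(2) E] has_wirt_mult[OF DE(1) DE(2)],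
              folded R_def] _ refl]])
      (simp add: ring_distribs mult_ac power2_eq_square)
qed

text \<open>
This is \<open>|U|\<^sup>2 = \<partial>\<^sub>z \<partial>\<^sub>b log D\<close>. Capital letters stand for the complex conjugates of the small ones;
holomorphic and antiholomorphic quantities are treated as independent, which makes the claim a
polynomial identity. It is Lagrange's identity for the vectors \<open>(g, h)\<close> and \<open>(g', h')\<close>.
\<close>

lemma data_modulus_identity:
  fixes f1 F1 g G g1 G1 h H D :: complex
  assumes "D = g * G + h * H" "D \<noteq> 0"
  shows "(G1 * (f1 * g - h) * inverse D) * (g1 * (F1 * G - H) * inverse D)
    = (g1 * G1 + f1 * g1 * (F1 * G1)) * inverse D
      - ((g1 * G + f1 * g1 * H) * inverse D) * ((g * G1 + h * (F1 * G1)) * inverse D)"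
proof -
  have "(G1 * (f1 * g - h)) * (g1 * (F1 * G - H))
      = (g1 * G1 + f1 * g1 * (F1 * G1)) * D - (g1 * G + f1 * g1 * H) * (g * G1 + h * (F1 * G1))"
    unfolding assms(1) by algebra
  moreover have "inverse D * D = 1" using assms(2) by simp
  ultimately show ?thesis by algebra
qed

text \<open>
The evolution equation at one point, with capital letters for conjugates as before and with
\<open>q' = f'' g\<close>, \<open>q'' = f''' g + f'' g'\<close>, \<open>g\<^sub>t = - \<i> g''\<close> and the \<open>z\<close>-derivatives of the linear equations
inserted: the left side is \<open>U\<^sub>t\<close>, the right side is \<open>\<i>\<close> times the sum of \<open>U\<^sub>z\<^sub>z\<close>, \<open>U\<^sub>b\<^sub>b\<close> and
\<open>2 (V + cnj V) U\<close>. The terms with \<open>E\<^sup>3\<close> and those with \<open>G3\<close> cancel; multiplied by \<open>D\<^sup>2\<close>, the rest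
becomes the polynomial identity \<open>key\<close>.
\<close>

lemma data_evolution_identity:
  fixes f1 F1 f2 F2 f3 g G g1 G1 g2 G2 G3 h H h_t H_t q D E D\<^sub>z D\<^sub>b D\<^sub>z\<^sub>z D\<^sub>b\<^sub>b :: complex
  assumes D: "D = g * G + h * H" and E: "E * D = 1" and q: "q = f1 * g - h"
    and h_t: "\<i> * h_t = g2 * f1 - g1 * f2" "- \<i> * H_t = G2 * F1 - G1 * F2"
    and D1: "D\<^sub>z = g1 * G + f1 * g1 * H" "D\<^sub>b = g * G1 + h * (F1 * G1)"
    and D2: "D\<^sub>z\<^sub>z = g2 * G + (f2 * g1 + f1 * g2) * H" "D\<^sub>b\<^sub>b = g * G2 + h * (F2 * G1 + F1 * G2)"
  shows "\<i> * ((\<i> * G3 * q + G1 * (\<i> * f3 * g + f1 * (- \<i> * g2) - h_t)) * E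
        - G1 * q * (- \<i> * g2 * G + g * (\<i> * G2) + h_t * H + h * H_t) * E^2)
    = \<i> * (\<i> * G1 * ((f3 * g + f2 * g1) * E - 2 * (f2 * g) * D\<^sub>z * E^2 - q * D\<^sub>z\<^sub>z * E^2
              + 2 * q * D\<^sub>z^2 * E^3)
          + \<i> * q * (G3 * E - 2 * G2 * D\<^sub>b * E^2 - G1 * D\<^sub>b\<^sub>b * E^2 + 2 * G1 * D\<^sub>b^2 * E^3)
          + 2 * (D\<^sub>z\<^sub>z * E - (D\<^sub>z * E) * (D\<^sub>z * E) + (D\<^sub>b\<^sub>b * E - (D\<^sub>b * E) * (D\<^sub>b * E)))
              * (\<i> * G1 * q * E))" (is "?L = ?R")
proof -
  \<comment> \<open>This is \<open>\<i> D\<^sub>t\<close> after elimination of \<open>h_t\<close> and \<open>H_t\<close>; it contains no imaginary unit.\<close>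
  define d where "d = g2 * G - g * G2 + (g2 * f1 - g1 * f2) * H - h * (G2 * F1 - G1 * F2)"
  have key: "(g1 * f2 - f3 * g) * G1 * D - G1 * q * d
      = - (G1 * (f3 * g + f2 * g1) * D - 2 * G1 * (f2 * g) * D\<^sub>z - 2 * q * G2 * D\<^sub>b
           + G1 * q * (D\<^sub>z\<^sub>z + D\<^sub>b\<^sub>b))"
    unfolding d_def D q D1 D2 by algebra
  have ii: "\<i> * (\<i> * x) = - x" for x by (simp flip: mult.assoc)
  have ht: "h_t = - \<i> * (g2 * f1 - g1 * f2)" "H_t = \<i> * (G2 * F1 - G1 * F2)"
    unfolding h_t[symmetric] by (simp_all add: algebra_simps)
  \<comment> \<open>Brings the terms of first order in \<open>E\<close> to the common factor \<open>E\<^sup>2\<close>.\<close>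
  have E2: "x * E = x * D * E^2" for x
    using E by (simp add: power2_eq_square mult_ac)
  have "?L = - G3 * q * E + ((g1 * f2 - f3 * g) * G1) * E - G1 * q * d * E^2"
    unfolding d_def ht by (simp add: algebra_simps ii)
  also have "\<dots> = - G3 * q * E + ((g1 * f2 - f3 * g) * G1 * D - G1 * q * d) * E^2"
    using E2[of "(g1 * f2 - f3 * g) * G1"] by (simp add: left_diff_distrib)
  also have "\<dots> = - G3 * q * E - (G1 * (f3 * g + f2 * g1)) * D * E^2 - (- 2 * G1 * (f2 * g) * D\<^sub>z
      - 2 * q * G2 * D\<^sub>b + G1 * q * (D\<^sub>z\<^sub>z + D\<^sub>b\<^sub>b)) * E^2"
    unfolding key by (simp add: algebra_simps)
  also have "\<dots> = - G3 * q * E - (G1 * (f3 * g + f2 * g1)) * E - (- 2 * G1 * (f2 * g) * D\<^sub>z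
      - 2 * q * G2 * D\<^sub>b + G1 * q * (D\<^sub>z\<^sub>z + D\<^sub>b\<^sub>b)) * E^2"
    unfolding E2[symmetric] ..
  also have "\<dots> = ?R"
    by (simp add: algebra_simps ii power2_eq_square power3_eq_cube)
  finally show ?thesis .
qed

lemma has_vector_derivative_inverse:
  fixes D :: "real \<Rightarrow> complex"
  assumes "(D has_vector_derivative d) (at t)" "D t \<noteq> 0"
  shows "((\<lambda>s. inverse (D s)) has_vector_derivative - d * (inverse (D t))^2) (at t)"
  using Deriv.has_derivative_inverse[OF assms(2) assms(1)[unfolded has_vector_derivative_def]]
  unfolding has_vector_derivative_def by (simp add: power2_eq_square mult_ac)

lemma has_wirt_hermitian:
  assumes "(a has_field_derivative a') (at z)" "(b has_field_derivative b') (at z)"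
    "(c has_field_derivative c') (at z)" "(d has_field_derivative d') (at z)"
  shows "has_wirt (\<lambda>w. a w * cnj (b w) + c w * cnj (d w))
    (a' * cnj (b z) + c' * cnj (d z)) (a z * cnj b' + c z * cnj d') z"
  by (rule has_wirt_eq[OF has_wirt_add[OF
        has_wirt_mult[OF has_wirt_holo[OF assms(1)] has_wirt_cnj[OF has_wirt_holo[OF assms(2)]]]
        has_wirt_mult[OF has_wirt_holo[OF assms(3)] has_wirt_cnj[OF has_wirt_holo[OF assms(4)]]]]])
    simp_all

text \<open>
The time derivatives of \<open>f'\<close> and \<open>g'\<close> are prescribed separately: they are the \<open>z\<close>-derivatives of
\<open>f\<^sub>t = \<i> f''\<close> and \<open>g\<^sub>t = - \<i> g''\<close>, but no joint regularity in \<open>(z, t)\<close> is assumed that would allow the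
two differentiations to be exchanged. The potential is \<open>V = \<partial>\<^sub>z\<^sup>2 log D\<close>.
\<close>

theorem data_solves_DSII:
  fixes f g h :: "complex \<Rightarrow> real \<Rightarrow> complex"
  assumes f: "\<And>t. (\<lambda>w. f w t) holomorphic_on UNIV"
      "\<And>z t. zder f z differentiable (at t)"
      "\<And>z t. tder (zder f) z t = \<i> * zder (zder (zder f)) z t"
    and g: "\<And>t. (\<lambda>w. g w t) holomorphic_on UNIV"
      "\<And>z t. g z differentiable (at t)"
      "\<And>z t. tder g z t = - \<i> * zder (zder g) z t"
      "\<And>z t. zder g z differentiable (at t)"
      "\<And>z t. tder (zder g) z t = - \<i> * zder (zder (zder g)) z t"
    and h: "\<And>t. (\<lambda>w. h w t) holomorphic_on UNIV"
      "\<And>z t. h z differentiable (at t)"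
      "\<And>z t. zder h z t = zder f z t * zder g z t"
      "\<And>z t. \<i> * tder h z t = zder (zder g) z t * zder f z t - zder g z t * zder (zder f) z t"
  shows "solves_DSII (data_U f g h) {(z, t). data_denom g h z t \<noteq> 0}"
proof -
  define f1 f2 f3 where "f1 = zder f" and "f2 = zder f1" and "f3 = zder f2"
  define g1 g2 g3 where "g1 = zder g" and "g2 = zder g1" and "g3 = zder g2"
  note defs = f1_def f2_def f3_def g1_def g2_def g3_def
  have zder_holo: "(\<lambda>w. zder k w t) holomorphic_on UNIV"
    if "(\<lambda>w. k w t) holomorphic_on UNIV" for k t
    unfolding zder_def using that by (rule holomorphic_deriv) simp
  have zder: "((\<lambda>w. k w t) has_field_derivative zder k z t) (at z)"
    if "(\<lambda>w. k w t) holomorphic_on UNIV" for k t z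
    unfolding zder_def using that by (intro holomorphic_derivI[of _ UNIV]) auto
  have tder: "(k z has_vector_derivative tder k z t) (at t)"
    if "k z differentiable (at t)" for k z t
    using that by (simp add: tder_def vector_derivative_works)
  note hf = f(1) zder_holo[OF f(1)] and hg = g(1) zder_holo[OF g(1)]
  have df: "((\<lambda>w. f1 w t) has_field_derivative f2 z t) (at z)"
    "((\<lambda>w. f2 w t) has_field_derivative f3 z t) (at z)"
    and dg: "((\<lambda>w. g w t) has_field_derivative g1 z t) (at z)"
    "((\<lambda>w. g1 w t) has_field_derivative g2 z t) (at z)"
    "((\<lambda>w. g2 w t) has_field_derivative g3 z t) (at z)"
    and dh: "((\<lambda>w. h w t) has_field_derivative f1 z t * g1 z t) (at z)" for z t
    using zder[of h t z, OF h(1)] unfolding h(3) defs by (auto intro!: zder hf hg zder_holo)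
  have tf: "(f1 z has_vector_derivative \<i> * f3 z t) (at t)"
    and tg: "(g z has_vector_derivative - \<i> * g2 z t) (at t)"
    "(g1 z has_vector_derivative - \<i> * g3 z t) (at t)"
    and th: "(h z has_vector_derivative tder h z t) (at t)" for z t
    using tder[of f1 z t] tder[of g z t] tder[of g1 z t] tder[of h z t] f g h
    unfolding defs by auto

  define D where "D z t = g z t * cnj (g z t) + h z t * cnj (h z t)" for z t
  define E where "E z t = inverse (D z t)" for z t
  define q where "q z t = f1 z t * g z t - h z t" for z t
  define h2 where "h2 z t = f2 z t * g1 z t + f1 z t * g2 z t" for z t
  define D\<^sub>z where "D\<^sub>z z t = g1 z t * cnj (g z t) + f1 z t * g1 z t * cnj (h z t)" for z t
  define D\<^sub>b where "D\<^sub>b z t = g z t * cnj (g1 z t) + h z t * cnj (f1 z t * g1 z t)" for z t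
  define D\<^sub>z\<^sub>z where "D\<^sub>z\<^sub>z z t = g2 z t * cnj (g z t) + h2 z t * cnj (h z t)" for z t
  define D\<^sub>z\<^sub>b where "D\<^sub>z\<^sub>b z t = g1 z t * cnj (g1 z t) + f1 z t * g1 z t * cnj (f1 z t * g1 z t)" for z t
  define D\<^sub>b\<^sub>b where "D\<^sub>b\<^sub>b z t = g z t * cnj (g2 z t) + h z t * cnj (h2 z t)" for z t
  define V where "V z t = D\<^sub>z\<^sub>z z t * E z t - (D\<^sub>z z t * E z t) * (D\<^sub>z z t * E z t)" for z t
  define U where "U = data_U f g h"
  have D_denom: "D z t = of_real (data_denom g h z t)" for z t
    by (simp only: D_def data_denom_def complex_norm_square of_real_add)
  have U: "U z t = \<i> * cnj (g1 z t) * q z t * E z t" for z t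
    unfolding U_def data_U_def E_def D_denom q_def f1_def g1_def by (simp add: divide_inverse)

  have dh2: "((\<lambda>w. f1 w t * g1 w t) has_field_derivative h2 z t) (at z)" for z t
    unfolding h2_def by (rule derivative_eq_intros df dg refl | simp)+
  have dq: "((\<lambda>w. q w t) has_field_derivative f2 z t * g z t) (at z)"
    "((\<lambda>w. f2 w t * g w t) has_field_derivative f3 z t * g z t + f2 z t * g1 z t) (at z)" for z t
    unfolding q_def by (rule derivative_eq_intros df dg dh refl | simp)+
  define h3 where "h3 z t = f3 z t * g1 z t + 2 * (f2 z t * g2 z t) + f1 z t * g3 z t" for z t
  have dh3: "((\<lambda>w. h2 w t) has_field_derivative h3 z t) (at z)" for z t
    unfolding h2_def h3_def by (rule derivative_eq_intros df dg refl | simp)+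

  have wD: "has_wirt (\<lambda>w. D w t) (D\<^sub>z z t) (D\<^sub>b z t) z"
    "has_wirt (\<lambda>w. D\<^sub>z w t) (D\<^sub>z\<^sub>z z t) (D\<^sub>z\<^sub>b z t) z"
    "has_wirt (\<lambda>w. D\<^sub>b w t) (D\<^sub>z\<^sub>b z t) (D\<^sub>b\<^sub>b z t) z" for z t
    unfolding D_def D\<^sub>z_def D\<^sub>b_def D\<^sub>z\<^sub>z_def D\<^sub>z\<^sub>b_def D\<^sub>b\<^sub>b_def
    by (rule has_wirt_hermitian[OF dg(1) dg(1) dh dh] has_wirt_hermitian[OF dg(2) dg(1) dh2 dh]
        has_wirt_hermitian[OF dg(1) dg(2) dh dh2])+

  have "solves_DSII_with U V {(z, t). data_denom g h z t \<noteq> 0}"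
    unfolding solves_DSII_with_def
  proof (clarify)
    fix z t assume "data_denom g h z t \<noteq> 0"
    then have Dz: "D z t \<noteq> 0" by (simp add: D_denom)
    define S where "S = {w. D w t \<noteq> 0}"
    have "continuous (at w) (\<lambda>w. D w t)" for w
      using wD(1) has_wirt_imp_differentiable differentiable_imp_continuous_within by blast
    then have "open S" unfolding S_def
      by (intro open_Collect_neq continuous_on_const) (simp add: continuous_at_imp_continuous_on)
    then have S: "open S" "z \<in> S" using Dz by (simp_all add: S_def)
    note U_space = second_wirt_quotient[where U = "\<lambda>w. U w t" and D = "\<lambda>w. D w t",
        OF S dg(2) dg(3) dq wD _ U[unfolded E_def], folded E_def, unfolded S_def mem_Collect_eq,
        simplified]

    have wD2: "has_wirt (\<lambda>w. D\<^sub>z\<^sub>z w t) (g3 z t * cnj (g z t) + h3 z t * cnj (h z t))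
        (g2 z t * cnj (g1 z t) + h2 z t * cnj (f1 z t * g1 z t)) z"
      "has_wirt (\<lambda>w. D\<^sub>z\<^sub>b w t) (g2 z t * cnj (g1 z t) + h2 z t * cnj (f1 z t * g1 z t))
        (g1 z t * cnj (g2 z t) + f1 z t * g1 z t * cnj (h2 z t)) z"
      unfolding D\<^sub>z\<^sub>z_def D\<^sub>z\<^sub>b_def
      by (rule has_wirt_hermitian[OF dg(3) dg(1) dh3 dh] has_wirt_hermitian[OF dg(2) dg(2) dh2 dh2])+
    obtain a b c where
      V: "has_wirt (\<lambda>w. V w t) a b z" and
      R: "has_wirt (\<lambda>w. D\<^sub>z\<^sub>b w t * E w t - (D\<^sub>z w t * E w t) * (D\<^sub>b w t * E w t)) b c z"
      using wirt_bar_log_zz_eq_wirt_log_zb[where D = "\<lambda>w. D w t", OF wD(1) Dz wD(2,3) wD2]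
      unfolding V_def E_def by blast
    have "complex_of_real ((cmod (U w t))\<^sup>2)
        = D\<^sub>z\<^sub>b w t * E w t - (D\<^sub>z w t * E w t) * (D\<^sub>b w t * E w t)" if "w \<in> S" for w
    proof -
      have "complex_of_real ((cmod (U w t))\<^sup>2)
        = (cnj (g1 w t) * q w t * E w t) * (g1 w t * cnj (q w t) * E w t)"
        unfolding complex_norm_square U by (simp add: E_def D_def mult_ac)
      then show ?thesis
        using data_modulus_identity[OF D_def, of w t "cnj (g1 w t)" "f1 w t" "g1 w t" "cnj (f1 w t)"] that
        unfolding S_def E_def q_def D\<^sub>z_def D\<^sub>b_def D\<^sub>z\<^sub>b_def by simp
    qed
    then have "has_wirt (\<lambda>w. complex_of_real ((cmod (U w t))\<^sup>2)) b c z"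
      by (rule has_wirt_cong_open[OF R S])
    note potential = has_wirt_imp_differentiable[OF V] has_wirt_imp_wirt(2)[OF V]
      has_wirt_imp_wirt(1)[OF this]

    define h_t where "h_t = tder h z t"
    define D_t where "D_t = - \<i> * g2 z t * cnj (g z t) + g z t * (\<i> * cnj (g2 z t))
      + h_t * cnj (h z t) + h z t * cnj h_t"
    have tD: "((\<lambda>s. D z s) has_vector_derivative D_t) (at t)"
      unfolding D_def D_t_def h_t_def
      by (rule has_vector_derivative_eq_rhs, (rule derivative_intros tg th)+) (simp add: algebra_simps)
    define U_t where "U_t = \<i> * ((\<i> * cnj (g3 z t) * q z t
        + cnj (g1 z t) * (\<i> * f3 z t * g z t + f1 z t * (- \<i> * g2 z t) - h_t)) * E z t
      - cnj (g1 z t) * q z t * D_t * (E z t)^2)"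
    have "((\<lambda>s. \<i> * cnj (g1 z s) * (f1 z s * g z s - h z s) * inverse (D z s))
        has_vector_derivative U_t) (at t)"
      by (rule has_vector_derivative_eq_rhs,
          (rule derivative_intros has_vector_derivative_inverse tg tf th tD Dz)+)
        (simp add: U_t_def q_def E_def h_t_def algebra_simps power2_eq_square)
    then have tU: "(U z has_vector_derivative U_t) (at t)"
      by (simp add: U[abs_def] q_def E_def)
    have h_t: "\<i> * h_t = g2 z t * f1 z t - g1 z t * f2 z t"
      unfolding h_t_def defs by (rule h(4))
    have h_t': "- \<i> * cnj h_t = cnj (g2 z t) * cnj (f1 z t) - cnj (g1 z t) * cnj (f2 z t)"
      using arg_cong[OF h_t, of cnj] by simp
    have cV: "cnj (V z t) = D\<^sub>b\<^sub>b z t * E z t - (D\<^sub>b z t * E z t) * (D\<^sub>b z t * E z t)"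
      by (simp add: V_def E_def D_def D\<^sub>z_def D\<^sub>b_def D\<^sub>z\<^sub>z_def D\<^sub>b\<^sub>b_def h2_def mult_ac)
    have evolution: "tder U z t =
        \<i> * (wirt (wirt (\<lambda>w. U w t)) z + wirt_bar (wirt_bar (\<lambda>w. U w t)) z
              + 2 * (V z t + cnj (V z t)) * U z t)"
      unfolding tder_def vector_derivative_at[OF tU] U_space(4,5)
      unfolding cV
      unfolding V_def U U_t_def D_t_def
      by (rule data_evolution_identity[OF D_def _ q_def h_t h_t'])
        (use Dz in \<open>simp_all add: E_def D\<^sub>z_def D\<^sub>b_def D\<^sub>z\<^sub>z_def D\<^sub>b\<^sub>b_def h2_def\<close>)
    show "U z differentiable (at t) \<and>
      (\<lambda>w. U w t) differentiable (at z) \<and>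
      wirt (\<lambda>w. U w t) differentiable (at z) \<and>
      wirt_bar (\<lambda>w. U w t) differentiable (at z) \<and>
      (\<lambda>w. V w t) differentiable (at z) \<and>
      tder U z t =
        \<i> * (wirt (wirt (\<lambda>w. U w t)) z + wirt_bar (wirt_bar (\<lambda>w. U w t)) z
              + 2 * (V z t + cnj (V z t)) * U z t) \<and>
      wirt_bar (\<lambda>w. V w t) z = wirt (\<lambda>w. complex_of_real ((cmod (U w t))\<^sup>2)) z"
      using U_space(1-3) evolution potential tU
      by (auto simp: S_def differentiableI_vector)
  qed
  then show ?thesis unfolding solves_DSII_def U_def by blast
qed

section \<open>Indeterminacy points of squared phases\<close>

lemma sgn_squared: "(sgn w)^2 = w^2 / of_real ((cmod w)^2)" for w :: complex
  by (simp add: sgn_eq power_divide)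

lemma filterlim_ray:
  fixes a v :: complex
  assumes "v \<noteq> 0"
  shows "filterlim (\<lambda>s::real. a + of_real s * v) (at a) (at_right 0)"
proof -
  have "((\<lambda>s::real. a + of_real s * v) \<longlongrightarrow> a + of_real 0 * v) (at_right 0)"
    by (intro tendsto_intros)
  then show ?thesis
    using assms unfolding filterlim_at eventually_at_right_field
    by (auto intro!: exI[of _ 1])
qed

text \<open>
Since \<open>sgn\<close> is invariant under positive scaling, \<open>P\<close> may be replaced by its difference quotient along
the ray, which has a nonzero limit.
\<close>

lemma sgn_squared_tendsto_along_ray:
  fixes P :: "complex \<Rightarrow> complex"
  assumes P: "(P has_field_derivative P') (at a)" "P a = 0" "P' \<noteq> 0" and v: "v \<noteq> 0"
  shows "((\<lambda>s. (sgn (P (a + of_real s * v)))^2) \<longlongrightarrow> (sgn (P' * v))^2) (at_right (0::real))"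
proof -
  have "((\<lambda>z. (P z - P a) / (z - a)) \<longlongrightarrow> P') (at a)"
    using P(1) by (simp add: has_field_derivative_iff)
  from tendsto_mult_right[OF filterlim_compose[OF this filterlim_ray[OF v]], of v]
  have "((\<lambda>s::real. P (a + of_real s * v) / of_real s) \<longlongrightarrow> P' * v) (at_right 0)"
    using v by (simp add: P(2))
  then have "((\<lambda>s::real. (sgn (P (a + of_real s * v) / of_real s))^2) \<longlongrightarrow> (sgn (P' * v))^2) (at_right 0)"
    using v P(3) by (intro tendsto_intros) auto
  moreover have "eventually (\<lambda>s::real. (sgn (P (a + of_real s * v) / of_real s))^2
      = (sgn (P (a + of_real s * v)))^2) (at_right 0)"
    unfolding eventually_at_right_field by (auto intro!: exI[of _ 1] simp: sgn_divide sgn_of_real)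
  ultimately show ?thesis by (rule Lim_transform_eventually)
qed

text \<open>
Along the ray in direction \<open>v\<close> the limit of \<open>u\<close> is \<open>C (sgn (P' v))\<^sup>2\<close>. The directions \<open>1\<close> and \<open>\<i>\<close> give
opposite nonzero values, so \<open>u\<close> has no limit, while \<open>|u| \<le> |K|\<close> keeps it bounded near \<open>a\<close>.
\<close>

lemma indeterminacy_at_sgn_squared:
  fixes P K u :: "complex \<Rightarrow> complex"
  assumes P: "(P has_field_derivative P') (at a)" "P a = 0" "P' \<noteq> 0"
    and K: "(K \<longlongrightarrow> C) (at a)" "C \<noteq> 0"
    and u: "\<And>z. u z = K z * (sgn (P z))^2"
  shows "indeterminacy_at u a"
    and "((\<lambda>z. u z / (C * (sgn (P z))^2)) \<longlongrightarrow> 1) (at a)"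
proof -
  have "eventually (\<lambda>z. norm (K z) < norm C + 1) (at a)"
    by (rule order_tendstoD(2)[OF tendsto_norm[OF K(1)]]) simp
  then have bounded: "Bfun u (at a)"
  proof (intro BfunI[of _ "norm C + 1"], eventually_elim)
    case (elim z)
    have "norm (u z) \<le> norm (K z)"
      by (simp add: u norm_mult norm_power norm_sgn)
    then show ?case using elim by linarith
  qed
  have ray: "((\<lambda>s. u (a + of_real s * v)) \<longlongrightarrow> C * (sgn (P' * v))^2) (at_right (0::real))"
    if "v \<noteq> 0" for v
    unfolding u using that P
    by (intro tendsto_mult filterlim_compose[OF K(1) filterlim_ray] sgn_squared_tendsto_along_ray)
  have "\<not> (u \<longlongrightarrow> L) (at a)" for L
  proof
    assume L: "(u \<longlongrightarrow> L) (at a)"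
    have lim: "L = C * (sgn (P' * v))^2" if "v \<noteq> 0" for v
      by (rule tendsto_unique[OF _ filterlim_compose[OF L filterlim_ray[OF that]] ray[OF that]]) simp
    have "C * (sgn P')^2 = C * (sgn (P' * \<i>))^2"
      by (rule trans[OF sym]) (use lim[of 1] lim[of \<i>] in simp_all)
    then show False using K(2) P(3)
      by (simp add: sgn_mult power_mult_distrib sgn_zero_iff) (simp add: sgn_eq)
  qed
  then show "indeterminacy_at u a" using bounded by (simp add: indeterminacy_at_def)

  have "((\<lambda>z. (P z - P a) / (z - a)) \<longlongrightarrow> P') (at a)"
    using P(1) by (simp add: has_field_derivative_iff)
  then have "eventually (\<lambda>z. (P z - P a) / (z - a) \<noteq> 0) (at a)"
    using P(3) by (rule tendsto_imp_eventually_ne)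
  then have "eventually (\<lambda>z. K z / C = u z / (C * (sgn (P z))^2)) (at a)"
    by eventually_elim (auto simp: u P(2) sgn_zero_iff)
  moreover have "((\<lambda>z. K z / C) \<longlongrightarrow> C / C) (at a)" by (intro tendsto_intros K)
  ultimately show "((\<lambda>z. u z / (C * (sgn (P z))^2)) \<longlongrightarrow> 1) (at a)"
    using K(2) by (simp cong: Lim_cong_within) (rule Lim_transform_eventually)
qed

section \<open>The polynomial data triple\<close>

lemma zder_eqI: "(\<And>z t. ((\<lambda>w. k w t) has_field_derivative k' z t) (at z)) \<Longrightarrow> zder k = k'"
  unfolding zder_def by (intro ext DERIV_imp_deriv)

text \<open>
The iterated derivatives are stated as a chain of rewrite rules, each for the right-hand side of the
one before, because rewriting replaces the innermost \<open>zder\<close> first.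
\<close>

lemma zder_f0:
  "zder f0 = (\<lambda>z t. 2 * z - 1)"
  "zder (\<lambda>z t. 2 * z - 1) = (\<lambda>z t. 2)"
  "zder (\<lambda>z t. 2) = (\<lambda>z t. 0)"
  unfolding f0_def by (rule zder_eqI; auto intro!: derivative_eq_intros)+

lemma zder_g0:
  "zder g0 = (\<lambda>z t. 3 * z^2 - (1 + 6 * \<i> * of_real t))"
  "zder (\<lambda>z t. 3 * z^2 - (1 + 6 * \<i> * of_real t)) = (\<lambda>z t. 6 * z)"
  "zder (\<lambda>z t. 6 * z) = (\<lambda>z t. 6)"
  unfolding g0_def by (rule zder_eqI; auto intro!: derivative_eq_intros)+

lemma zder_h0: "zder h0 = (\<lambda>z t. 6 * z^3 - 3 * z^2 - 2 * (1 + 6 * \<i> * of_real t) * z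
    + (1 + 6 * \<i> * of_real t))"
  unfolding h0_def
  by (rule zder_eqI) (auto intro!: derivative_eq_intros simp: algebra_simps)

lemma holomorphic_f0_g0_h0:
  "(\<lambda>w. f0 w t) holomorphic_on UNIV" "(\<lambda>w. g0 w t) holomorphic_on UNIV"
  "(\<lambda>w. h0 w t) holomorphic_on UNIV"
  unfolding f0_def g0_def h0_def by (intro holomorphic_intros)+

lemma time_derivatives:
  "(f0 z has_vector_derivative 2 * \<i>) (at t)"
  "(zder f0 z has_vector_derivative 0) (at t)"
  "(g0 z has_vector_derivative - 6 * \<i> * z) (at t)"
  "(zder g0 z has_vector_derivative - 6 * \<i>) (at t)"
  "(h0 z has_vector_derivative - \<i> * (6 * z^2 - 6 * z + 2 + 12 * \<i> * of_real t)) (at t)"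
proof -
  have "((\<lambda>s. f0 z s) has_vector_derivative 2 * \<i>) (at t)"
    unfolding f0_def
    by (rule has_vector_derivative_real_field[of "\<lambda>s. (z^2 + 2 * \<i> * s) - z"])
      (auto intro!: derivative_eq_intros)
  then show "(f0 z has_vector_derivative 2 * \<i>) (at t)" by simp
  show "(zder f0 z has_vector_derivative 0) (at t)"
    unfolding zder_f0 by simp
  have "((\<lambda>s. g0 z s) has_vector_derivative - 6 * \<i> * z) (at t)"
    unfolding g0_def
    by (rule has_vector_derivative_real_field[of "\<lambda>s. (z^3 - 6 * \<i> * s * z) - z"])
      (auto intro!: derivative_eq_intros)
  then show "(g0 z has_vector_derivative - 6 * \<i> * z) (at t)" by simp
  show "(zder g0 z has_vector_derivative - 6 * \<i>) (at t)"
    unfolding zder_g0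
    by (rule has_vector_derivative_real_field[of "\<lambda>s. 3 * z^2 - (1 + 6 * \<i> * s)"])
      (auto intro!: derivative_eq_intros)
  have "((\<lambda>s. h0 z s) has_vector_derivative - \<i> * (6 * z^2 - 6 * z + 2 + 12 * \<i> * of_real t)) (at t)"
    unfolding h0_def
    by (rule has_vector_derivative_real_field[of "\<lambda>s. 3/2 * z^4 - z^3 - (1 + 6 * \<i> * s) * z^2
          + (1 + 6 * \<i> * s) * z - \<i> * (2 * s + 6 * \<i> * s^2) - 1/2"])
      (auto intro!: derivative_eq_intros simp: algebra_simps)
  then show "(h0 z has_vector_derivative - \<i> * (6 * z^2 - 6 * z + 2 + 12 * \<i> * of_real t)) (at t)"
    by simp
qed

lemmas tder_f0_g0_h0 = time_derivatives[THEN vector_derivative_at, folded tder_def, unfolded zder_f0 zder_g0]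

lemma constraint_f0_g0_h0:
  "zder h0 z t = zder f0 z t * zder g0 z t"
  "\<i> * tder h0 z t = zder (zder g0) z t * zder f0 z t - zder g0 z t * zder (zder f0) z t"
proof -
  show "zder h0 z t = zder f0 z t * zder g0 z t"
    unfolding zder_h0 zder_f0 zder_g0 by algebra
  have "\<i> * tder h0 z t = (\<i> * - \<i>) * (6 * z^2 - 6 * z + 2 + 12 * \<i> * of_real t)"
    unfolding tder_f0_g0_h0 by (simp only: mult.assoc)
  then show "\<i> * tder h0 z t = zder (zder g0) z t * zder f0 z t - zder g0 z t * zder (zder f0) z t"
    unfolding zder_f0 zder_g0 by (simp add: algebra_simps power2_eq_square)
qed

lemma U0_solves_DSII: "solves_DSII U0 \<Omega>0"
  unfolding U0_def \<Omega>0_def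
  by (rule data_solves_DSII, unfold constraint_f0_g0_h0 tder_f0_g0_h0 zder_f0 zder_g0)
    (simp_all add: holomorphic_f0_g0_h0 algebra_simps power2_eq_square
      time_derivatives[THEN differentiableI_vector, unfolded zder_f0 zder_g0])

lemma data_at_0:
  "h0 z 0 = (z^2 - 1) * (3/2 * z^2 - z + 1/2)" "g0 z 0 = z * (z^2 - 1)"
  "zder f0 z 0 * g0 z 0 - h0 z 0 = (z^2 - 1)^2 / 2"
  unfolding h0_def g0_def zder_f0
  by (simp_all add: field_simps power2_eq_square power3_eq_cube power4_eq_xxxx)

lemma data_denom_0_eq_0_iff: "data_denom g0 h0 z 0 = 0 \<longleftrightarrow> z = 1 \<or> z = -1"
proof -
  have "data_denom g0 h0 z 0 = 0 \<longleftrightarrow> g0 z 0 = 0 \<and> h0 z 0 = 0"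
    unfolding data_denom_def by (simp add: sum_power2_eq_zero_iff)
  also have "\<dots> \<longleftrightarrow> z^2 = 1" unfolding data_at_0 by auto
  finally show ?thesis by (simp add: power2_eq_1_iff)
qed

text \<open>
The amplitude of \<open>U0\<close> at time \<open>0\<close>: what remains after the powers of \<open>z\<^sup>2 - 1\<close> and of its modulus are
divided out. Its denominator has no zeros, so it is continuous at the singular points of \<open>U0\<close> too.
\<close>

definition K0 :: "complex \<Rightarrow> complex" where
  "K0 z = \<i> * cnj (3 * z^2 - 1) / 2 / of_real ((cmod z)^2 + (cmod (3/2 * z^2 - z + 1/2))^2)"

lemma U0_at_0: "U0 z 0 = K0 z * (sgn (z^2 - 1))^2"
proof -
  have D: "data_denom g0 h0 z 0 = (cmod (z^2 - 1))^2 * ((cmod z)^2 + (cmod (3/2 * z^2 - z + 1/2))^2)"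
    unfolding data_denom_def data_at_0(1,2) norm_mult power_mult_distrib
    by (simp only: distrib_left mult.commute)
  have p: "zder g0 z 0 = 3 * z^2 - 1" by (simp add: zder_g0)
  show ?thesis
    unfolding U0_def data_U_def D data_at_0(3) p K0_def sgn_squared of_real_mult
    by (simp add: mult_ac del: of_real_add of_real_power complex_cnj_diff)
qed

lemma K0_denom_nonzero: "(cmod a)^2 + (cmod (3/2 * a^2 - a + 1/2))^2 \<noteq> 0"
  by (cases "a = 0") (simp_all add: sum_power2_eq_zero_iff)

lemma K0_tendsto: "(K0 \<longlongrightarrow> K0 a) (at a)"
  unfolding K0_def using K0_denom_nonzero[of a]
  by (intro tendsto_intros) (simp_all del: of_real_add)

lemma U0_singularity:
  assumes "a^2 = 1"
  shows "K0 a \<noteq> 0" "indeterminacy_at (\<lambda>z. U0 z 0) a"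
    "((\<lambda>z. U0 z 0 / (K0 a * ((z^2 - 1)^2 / of_real ((cmod (z^2 - 1))^2)))) \<longlongrightarrow> 1) (at a)"
proof -
  have a: "a \<noteq> 0" using assms by auto
  show K: "K0 a \<noteq> 0"
    unfolding K0_def using K0_denom_nonzero[of a] by (simp add: assms del: of_real_add)
  have P: "((\<lambda>z. z^2 - 1) has_field_derivative 2 * a) (at a)"
    by (auto intro!: derivative_eq_intros)
  note sing = indeterminacy_at_sgn_squared[OF P _ _ K0_tendsto K U0_at_0]
  show "indeterminacy_at (\<lambda>z. U0 z 0) a" by (rule sing(1)) (use a assms in auto)
  show "((\<lambda>z. U0 z 0 / (K0 a * ((z^2 - 1)^2 / of_real ((cmod (z^2 - 1))^2)))) \<longlongrightarrow> 1) (at a)"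
    unfolding sgn_squared[symmetric] by (rule sing(2)) (use a assms in auto)
qed

lemma U0_explicit:
  "U0 z t = \<i> * (3 * (cnj z)^2 - (1 - 6 * \<i> * of_real t))
      * (1/2 * z^4 - (1 + 6 * \<i> * of_real t) * z^2
          + \<i> * (2 * of_real t + 6 * \<i> * (of_real t)^2) + 1/2)
    / of_real
        ((cmod ((z^3 - 6 * \<i> * of_real t * z) - z))^2
         + (cmod (3/2 * z^4 - z^3 - (1 + 6 * \<i> * of_real t) * z^2
              + (1 + 6 * \<i> * of_real t) * z
              - \<i> * (2 * of_real t + 6 * \<i> * (of_real t)^2) - 1/2))^2)"
proof -
  have "zder f0 z t * g0 z t - h0 z t = 1/2 * z^4 - (1 + 6 * \<i> * of_real t) * z^2
      + \<i> * (2 * of_real t + 6 * \<i> * (of_real t)^2) + 1/2"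
    unfolding zder_f0 g0_def h0_def
    by (simp add: field_simps power2_eq_square power3_eq_cube power4_eq_xxxx)
  moreover have "cnj (zder g0 z t) = 3 * (cnj z)^2 - (1 - 6 * \<i> * of_real t)"
    unfolding zder_g0 by simp
  ultimately show ?thesis
    unfolding U0_def data_U_def data_denom_def by (simp only: g0_def h0_def)
qed

theorem mainTheorem1:
  shows
    "(\<forall>z t.
      (\<lambda>w. f0 w t) holomorphic_on UNIV \<and> f0 z differentiable (at t) \<and>
      (\<lambda>w. g0 w t) holomorphic_on UNIV \<and> g0 z differentiable (at t) \<and>
      (\<lambda>w. h0 w t) holomorphic_on UNIV \<and> h0 z differentiable (at t) \<and>
      tder f0 z t = \<i> * zder (zder f0) z t \<and>
      tder g0 z t = - \<i> * zder (zder g0) z t \<and>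
      zder f0 z t = 2 * z - 1 \<and>
      zder g0 z t = 3 * z^2 - (1 + 6 * \<i> * of_real t) \<and>
      zder h0 z t = zder f0 z t * zder g0 z t \<and>
      zder h0 z t = 6 * z^3 - 3 * z^2 - 2 * (1 + 6 * \<i> * of_real t) * z
                      + (1 + 6 * \<i> * of_real t) \<and>
      \<i> * tder h0 z t = zder (zder g0) z t * zder f0 z t - zder g0 z t * zder (zder f0) z t) \<and>
     h0 1 0 = 0 \<and>
     h0 (-1) 0 = 0 \<and>
     (\<forall>(z, t) \<in> \<Omega>0.
      U0 z t =
        \<i> * (3 * (cnj z)^2 - (1 - 6 * \<i> * of_real t))
          * (1/2 * z^4 - (1 + 6 * \<i> * of_real t) * z^2
              + \<i> * (2 * of_real t + 6 * \<i> * (of_real t)^2) + 1/2)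
        / of_real
            ((cmod ((z^3 - 6 * \<i> * of_real t * z) - z))^2
             + (cmod (3/2 * z^4 - z^3 - (1 + 6 * \<i> * of_real t) * z^2
                  + (1 + 6 * \<i> * of_real t) * z
                  - \<i> * (2 * of_real t + 6 * \<i> * (of_real t)^2) - 1/2))^2)) \<and>
     solves_DSII U0 \<Omega>0 \<and>
     (\<forall>z. h0 z 0 = 3/2 * z^4 - z^3 - z^2 + z - 1/2 \<and>
         h0 z 0 = (z^2 - 1) * (3/2 * z^2 - z + 1/2) \<and>
         g0 z 0 = z * (z^2 - 1) \<and>
         zder f0 z 0 * g0 z 0 - h0 z 0 = (z^2 - 1)^2 / 2) \<and>
     zder g0 1 0 \<noteq> 0 \<and>
     zder g0 (-1) 0 \<noteq> 0 \<and>
     {z. data_denom g0 h0 z 0 = 0} = {1, -1} \<and>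
     indeterminacy_at (\<lambda>z. U0 z 0) 1 \<and>
     indeterminacy_at (\<lambda>z. U0 z 0) (-1) \<and>
     (\<exists>C\<^sub>1 C\<^sub>2 :: complex.
      ((\<lambda>z. U0 z 0 / (C\<^sub>1 * ((z^2 - 1)^2 / of_real ((cmod (z^2 - 1))^2)))) \<longlongrightarrow> 1) (at 1) \<and>
      ((\<lambda>z. U0 z 0 / (C\<^sub>2 * ((z^2 - 1)^2 / of_real ((cmod (z^2 - 1))^2)))) \<longlongrightarrow> 1) (at (-1)))"
proof -
  have amplitude_limits: "\<exists>C\<^sub>1 C\<^sub>2 :: complex.
      ((\<lambda>z. U0 z 0 / (C\<^sub>1 * ((z^2 - 1)^2 / of_real ((cmod (z^2 - 1))^2)))) \<longlongrightarrow> 1) (at 1) \<and>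
      ((\<lambda>z. U0 z 0 / (C\<^sub>2 * ((z^2 - 1)^2 / of_real ((cmod (z^2 - 1))^2)))) \<longlongrightarrow> 1) (at (-1))"
    \<comment> \<open>The constants are \<open>K0 1 = \<i>/2\<close> and \<open>K0 (-1) = \<i>/10\<close>.\<close>
    by (intro exI[of _ "K0 1"] exI[of _ "K0 (-1)"] conjI U0_singularity) simp_all
  have at_zeros: "h0 1 0 = 0" "h0 (-1) 0 = 0" "zder g0 1 0 \<noteq> 0" "zder g0 (-1) 0 \<noteq> 0"
    by (simp_all add: data_at_0 zder_g0)
  have zeros: "{z. data_denom g0 h0 z 0 = 0} = {1, -1}"
    by (auto simp: data_denom_0_eq_0_iff)
  have indeterminacy: "indeterminacy_at (\<lambda>z. U0 z 0) 1" "indeterminacy_at (\<lambda>z. U0 z 0) (-1)"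
    by (rule U0_singularity; simp)+
  have h0_0: "h0 z 0 = 3/2 * z^4 - z^3 - z^2 + z - 1/2" for z by (simp add: h0_def)
  have smooth: "f0 z differentiable (at t)" "g0 z differentiable (at t)" "h0 z differentiable (at t)"
    for z t using time_derivatives differentiableI_vector by blast+
  have linear: "tder f0 z t = \<i> * zder (zder f0) z t" "tder g0 z t = - \<i> * zder (zder g0) z t" for z t
    unfolding tder_f0_g0_h0 zder_f0 zder_g0 by simp_all
  note zders = zder_f0(1)[THEN fun_cong, THEN fun_cong] zder_g0(1)[THEN fun_cong, THEN fun_cong]
    zder_h0[THEN fun_cong, THEN fun_cong]
  have explicit: "\<forall>(z, t) \<in> \<Omega>0. U0 z t =
      \<i> * (3 * (cnj z)^2 - (1 - 6 * \<i> * of_real t))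
        * (1/2 * z^4 - (1 + 6 * \<i> * of_real t) * z^2
            + \<i> * (2 * of_real t + 6 * \<i> * (of_real t)^2) + 1/2)
      / of_real
          ((cmod ((z^3 - 6 * \<i> * of_real t * z) - z))^2
           + (cmod (3/2 * z^4 - z^3 - (1 + 6 * \<i> * of_real t) * z^2
                + (1 + 6 * \<i> * of_real t) * z
                - \<i> * (2 * of_real t + 6 * \<i> * (of_real t)^2) - 1/2))^2)"
    using U0_explicit by blast
  show ?thesis
    by (intro conjI allI explicit amplitude_limits at_zeros zeros indeterminacy h0_0 smooth linear zders
        U0_solves_DSII holomorphic_f0_g0_h0 constraint_f0_g0_h0 data_at_0)
qed

end
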